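(* Let $S,\pi,J,a,r,K$ and $I$ be as in the context, with (A.1) and (A.2) in force. Let $\nu\in\mathcal{P}(S)$ with $I(\nu)<\infty$. Let $q(x,dy)$ be a transition kernel on $S$ with invariant distribution $\nu$ that attains the rate function, i.e. $I(\nu)=\int_S R(q(x,\cdot)\parallel K(x,\cdot))\,\nu(dx)$, and write it as $$q(x,dy)=\alpha(x,y)\,dy+\rho(x)\delta_x(dy)\quad\text{for }\nu\text{-almost every }x,$$ where $\alpha(x,\cdot)\ll a(x,\cdot)$ for $\nu$-almost every $x$ (with Lebesgue density $\alpha(x,y)$) and $\rho$ is a measurable function. Then $$I(\nu)=\int_S\int_S\log\left(\frac{\alpha(x,y)}{a(x,y)}\right)\alpha(x,y)\,dy\,\nu(dx)+\int_S\log\left(\frac{\rho(x)}{r(x)}\right)\rho(x)\,\nu(dx).$$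
   Context: **Spaces.** $S\subseteq\mathbb{R}^d$ ($d\ge1$) is a Polish space with Borel $\sigma$-algebra $\mathcal{B}(S)$; $\lambda$ denotes Lebesgue measure (on $S$: its restriction to $S$), and $dx=\lambda(dx)$. $\mathcal{P}(S)$ is the space of Borel probability measures on $S$. Measures and their Lebesgue densities are denoted by the same symbol. **Metropolis--Hastings kernel.** $\pi\in\mathcal{P}(S)$ is the target measure and $J(\cdot|x)\in\mathcal{P}(S)$, $x\in S$, is the proposal (a stochastic kernel). Let $$\varpi(x,y)=\min\left\{1,\frac{\pi(y)J(x|y)}{\pi(x)J(y|x)}\right\},\qquad \varpi(x,y)=1\text{ if }\pi(x)J(y|x)=0,$$ $a(x,y)=\varpi(x,y)J(y|x)$, $a(x,dy)=a(x,y)\,dy$, $r(x)=1-a(x,S)$, and $K(x,dy)=a(x,dy)+r(x)\delta_x(dy)$. **Assumptions.** (A.1) $\pi$ is equivalent to $\lambda$ on $S$, and the density $\pi(x)$ is a continuous function on $S$. (A.2) $J(\cdot|x)\ll\pi$ for all $x\in S$; the density $J(y|x)$ is a continuous and bounded function of $(x,y)$ and $J(y|x)>0$ for all $(x,y)\in S^2$. **Rate function.** $R(\mu\parallel\nu)=\int\log\frac{d\mu}{d\nu}\,d\mu$ if $\mu\ll\nu$ and $+\infty$ otherwise. $A(\mu)=\{\gamma\in\mathcal{P}(S^2): \text{both marginals of }\gamma\text{ equal }\mu\}$, $(\mu\otimes K)(dx\times dy)=\mu(dx)K(x,dy)$, and $I(\mu)=\inf_{\gamma\in A(\mu)}R(\gamma\parallel\mu\otimes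 K)$; equivalently $I(\mu)=\inf_q\int_S R(q(x,\cdot)\parallel K(x,\cdot))\mu(dx)$, the infimum being over transition kernels $q$ for which $\mu$ is invariant ($\mu(A)=\int_S q(x,A)\mu(dx)$ for all $A\in\mathcal{B}(S)$). When $I(\mu)<\infty$ the infimum over $q$ is attained. **Convention.** Integrands of the form $\log(u/v)\,u$ are $0$ when $u=0$. *)

theory Defs
  imports "HOL-Probability.Probability"
begin

abbreviation borel_on :: "'a::topological_space set \<Rightarrow> 'a measure" where
  "borel_on S \<equiv> restrict_space borel S"

abbreviation leb_on :: "'a::euclidean_space set \<Rightarrow> 'a measure" where
  "leb_on S \<equiv> restrict_space lborel S"

definition polish_subset :: "'a::topological_space set \<Rightarrow> bool" where
  "polish_subset S \<longleftrightarrow>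
     completely_metrizable_space (top_of_set S) \<and> separable_space (top_of_set S)"

text \<open>Integral with values in the extended reals, positive part minus negative part
  (\<^const>\<open>e2ennreal\<close> truncates at zero). It is finite only if both parts are finite, because
  \<open>\<infinity> - \<infinity> = \<infinity>\<close> in \<^typ>\<open>ereal\<close>.\<close>

definition ereal_integral :: "'a measure \<Rightarrow> ('a \<Rightarrow> ereal) \<Rightarrow> ereal" where
  "ereal_integral M f =
     enn2ereal (\<integral>\<^sup>+ x. e2ennreal (f x) \<partial>M) - enn2ereal (\<integral>\<^sup>+ x. e2ennreal (- f x) \<partial>M)"

text \<open>The integrand \<open>log (u / v) u\<close> for \<open>u, v \<ge> 0\<close>. The case \<open>v = 0 < u\<close> has to be singled out,
  since \<open>u / 0 = 0\<close> and \<open>ln 0 = 0\<close> in the library.\<close>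

definition log_ratio :: "real \<Rightarrow> real \<Rightarrow> ereal" where
  "log_ratio u v = (if u = 0 then 0 else if v = 0 then \<infinity> else ereal (ln (u / v) * u))"

definition rel_entropy :: "'a measure \<Rightarrow> 'a measure \<Rightarrow> ereal" where
  "rel_entropy \<mu> \<nu> =
     (if absolutely_continuous \<nu> \<mu>
      then ereal_integral \<mu> (\<lambda>x. ereal (entropy_density (exp 1) \<nu> \<mu> x)) else \<infinity>)"

text \<open>Below, \<open>p x\<close> is the Lebesgue density \<open>\<pi>(x)\<close> and \<open>j x y\<close> is the proposal density \<open>J(y|x)\<close>:
  the conditioning point is the first argument.\<close>

definition assumption_A1 :: "'a::euclidean_space set \<Rightarrow> 'a measure \<Rightarrow> ('a \<Rightarrow> real) \<Rightarrow> bool" where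
  "assumption_A1 S \<pi> p \<longleftrightarrow>
     absolutely_continuous (leb_on S) \<pi> \<and> absolutely_continuous \<pi> (leb_on S) \<and>
     (\<forall>x\<in>S. 0 \<le> p x) \<and> \<pi> = density (leb_on S) (\<lambda>x. ennreal (p x)) \<and>
     continuous_on S p"

definition assumption_A2 ::
  "'a::euclidean_space set \<Rightarrow> 'a measure \<Rightarrow> ('a \<Rightarrow> 'a measure) \<Rightarrow> ('a \<Rightarrow> 'a \<Rightarrow> real) \<Rightarrow> bool" where
  "assumption_A2 S \<pi> J j \<longleftrightarrow>
     (\<forall>x\<in>S. absolutely_continuous \<pi> (J x)) \<and>
     (\<forall>x\<in>S. J x = density (leb_on S) (\<lambda>y. ennreal (j x y))) \<and>
     continuous_on (S \<times> S) (\<lambda>(x, y). j x y) \<and>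
     (\<exists>C. \<forall>x\<in>S. \<forall>y\<in>S. j x y \<le> C) \<and>
     (\<forall>x\<in>S. \<forall>y\<in>S. 0 < j x y)"

definition mh_accept :: "('a \<Rightarrow> real) \<Rightarrow> ('a \<Rightarrow> 'a \<Rightarrow> real) \<Rightarrow> 'a \<Rightarrow> 'a \<Rightarrow> real" where
  "mh_accept p j x y =
     (if p x * j x y = 0 then 1 else min 1 ((p y * j y x) / (p x * j x y)))"

definition mh_a :: "('a \<Rightarrow> real) \<Rightarrow> ('a \<Rightarrow> 'a \<Rightarrow> real) \<Rightarrow> 'a \<Rightarrow> 'a \<Rightarrow> real" where
  "mh_a p j x y = mh_accept p j x y * j x y"

definition mh_r ::
  "'a::euclidean_space set \<Rightarrow> ('a \<Rightarrow> real) \<Rightarrow> ('a \<Rightarrow> 'a \<Rightarrow> real) \<Rightarrow> 'a \<Rightarrow> real" where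
  "mh_r S p j x = 1 - (LINT y|leb_on S. mh_a p j x y)"

text \<open>The measure \<open>f(y) dy + c \<delta>\<^sub>x(dy)\<close> on \<open>S\<close>.\<close>

definition dens_plus_atom ::
  "'a::euclidean_space set \<Rightarrow> ('a \<Rightarrow> ennreal) \<Rightarrow> ennreal \<Rightarrow> 'a \<Rightarrow> 'a measure" where
  "dens_plus_atom S f c x =
     measure_of (space (borel_on S)) (sets (borel_on S))
       (\<lambda>A. (\<integral>\<^sup>+ y\<in>A. f y \<partial>leb_on S) + c * indicator A x)"

definition mh_kernel ::
  "'a::euclidean_space set \<Rightarrow> ('a \<Rightarrow> real) \<Rightarrow> ('a \<Rightarrow> 'a \<Rightarrow> real) \<Rightarrow> 'a \<Rightarrow> 'a measure" where
  "mh_kernel S p j x =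
     dens_plus_atom S (\<lambda>y. ennreal (mh_a p j x y)) (ennreal (mh_r S p j x)) x"

lemma sets_leb_on: "sets (leb_on S) = sets (borel_on S)"
  by (intro sets_restrict_space_cong) simp

lemma sets_dens_plus_atom: "sets (dens_plus_atom S f c x) = sets (borel_on S)"
  unfolding dens_plus_atom_def by simp

lemma emeasure_dens_plus_atom:
  assumes f: "f \<in> borel_measurable (borel_on S)" and A: "A \<in> sets (borel_on S)"
  shows "emeasure (dens_plus_atom S f c x) A =
           (\<integral>\<^sup>+ y\<in>A. f y \<partial>leb_on S) + c * indicator A x"
proof (rule emeasure_measure_of[OF dens_plus_atom_def])
  let ?m = "\<lambda>A. (\<integral>\<^sup>+ y\<in>A. f y \<partial>leb_on S) + c * indicator A x"
  have fl: "f \<in> borel_measurable (leb_on S)"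
    using f by (simp add: measurable_cong_sets[OF sets_leb_on refl])
  show "sets (borel_on S) \<subseteq> Pow (space (borel_on S))"
    by (rule sets.space_closed)
  show "A \<in> sets (dens_plus_atom S f c x)"
    using A by (simp add: sets_dens_plus_atom)
  show "positive (sets (dens_plus_atom S f c x)) ?m"
    by (simp add: positive_def)
  show "countably_additive (sets (dens_plus_atom S f c x)) ?m"
  proof (rule countably_additiveI)
    fix B :: "nat \<Rightarrow> 'a set"
    assume B: "range B \<subseteq> sets (dens_plus_atom S f c x)" and dj: "disjoint_family B"
    have B': "range B \<subseteq> sets (density (leb_on S) f)"
      using B by (simp add: sets_dens_plus_atom sets_leb_on)
    have eq: "emeasure (density (leb_on S) f) C = (\<integral>\<^sup>+ y\<in>C. f y \<partial>leb_on S)"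
      if "C \<in> sets (leb_on S)" for C
      using that fl by (rule emeasure_density[rotated])
    have "(\<Sum>i. ?m (B i)) =
        (\<Sum>i. \<integral>\<^sup>+ y\<in>B i. f y \<partial>leb_on S) + (\<Sum>i. c * indicator (B i) x)"
      by (rule suminf_add[symmetric]) auto
    also have "(\<Sum>i. c * indicator (B i) x) = c * indicator (\<Union>i. B i) x"
      by (simp add: suminf_indicator[OF dj])
    also have "(\<Sum>i. \<integral>\<^sup>+ y\<in>B i. f y \<partial>leb_on S) = (\<integral>\<^sup>+ y\<in>(\<Union>i. B i). f y \<partial>leb_on S)"
    proof -
      have "(\<Union>i. B i) \<in> sets (leb_on S)" "\<And>i. B i \<in> sets (leb_on S)"
        using B' by auto
      then show ?thesis
        using suminf_emeasure[OF B' dj] by (simp add: eq)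
    qed
    finally show "(\<Sum>i. ?m (B i)) = ?m (\<Union>i. B i)" .
  qed
qed

definition couplings :: "'a::topological_space set \<Rightarrow> 'a measure \<Rightarrow> ('a \<times> 'a) measure set" where
  "couplings S \<mu> =
     {\<gamma> \<in> space (prob_algebra (borel_on S \<Otimes>\<^sub>M borel_on S)).
        distr \<gamma> (borel_on S) fst = \<mu> \<and> distr \<gamma> (borel_on S) snd = \<mu>}"

text \<open>\<open>(\<mu> \<otimes> K)(dx \<times> dy) = \<mu>(dx) K(x, dy)\<close>.\<close>

definition kernel_prod ::
  "'a::topological_space set \<Rightarrow> 'a measure \<Rightarrow> ('a \<Rightarrow> 'a measure) \<Rightarrow> ('a \<times> 'a) measure" where
  "kernel_prod S \<mu> K = \<mu> \<bind> (\<lambda>x. distr (K x) (borel_on S \<Otimes>\<^sub>M borel_on S) (Pair x))"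

definition rate_fun ::
  "'a::topological_space set \<Rightarrow> ('a \<Rightarrow> 'a measure) \<Rightarrow> 'a measure \<Rightarrow> ereal" where
  "rate_fun S K \<mu> = (INF \<gamma>\<in>couplings S \<mu>. rel_entropy \<gamma> (kernel_prod S \<mu> K))"

definition invariant_for :: "'a measure \<Rightarrow> ('a \<Rightarrow> 'a measure) \<Rightarrow> bool" where
  "invariant_for \<mu> q \<longleftrightarrow>
     (\<forall>A\<in>sets \<mu>. emeasure \<mu> A = (\<integral>\<^sup>+ x. emeasure (q x) A \<partial>\<mu>))"

end

theory Submission
  imports Defs
begin

text \<open>For \<open>\<nu>\<close>-almost every \<open>x\<close>, the density of \<open>q(x, dy)\<close> with respect to \<open>K(x, dy)\<close> is
  \<open>\<alpha>(x, y) / a(x, y)\<close> off \<open>x\<close> and \<open>\<rho>(x) / r(x)\<close> at \<open>x\<close>, because \<open>{x}\<close> is a Lebesgue null set; if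
  absolute continuity fails, then \<open>r(x) = 0 < \<rho>(x)\<close> and both sides are infinite. So the relative
  entropy splits pointwise into a density term and an atom term. From \<open>log t \<le> t - 1\<close> the negative
  parts of the two terms are at most \<open>\<integral> a(x, y) dy \<le> 1\<close> and \<open>r(x) \<le> 1\<close>, which makes integration
  against \<open>\<nu>\<close> additive.\<close>

section \<open>Arithmetic of positive and negative parts, and additivity of
  \<open>ereal_integral\<close>\<close>

lemma ennreal_add_le: "ennreal (x + y) \<le> ennreal x + ennreal y"
proof -
  have "ennreal (x + y) \<le> ennreal (max 0 x + max 0 y)"
    by (intro ennreal_leI) auto
  also have "\<dots> = ennreal (max 0 x) + ennreal (max 0 y)"
    by (rule ennreal_plus) auto
  finally show ?thesis by (simp add: max_def ennreal_neg split: if_splits)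
qed

text \<open>This is a + b written as positive minus negative parts, rearranged so that nothing is
  subtracted. In this form it can be integrated term by term in \<open>ennreal\<close>.\<close>

lemma e2ennreal_add_parts:
  assumes "a \<noteq> -\<infinity>" "b \<noteq> -\<infinity>"
  shows "e2ennreal (a + b) + (e2ennreal (- a) + e2ennreal (- b)) =
         e2ennreal (- (a + b)) + (e2ennreal a + e2ennreal b)"
proof -
  have *: "ennreal (x + y) + (ennreal (- x) + ennreal (- y)) =
           ennreal (- x - y) + (ennreal x + ennreal y)" for x y :: real
  proof -
    have m: "ennreal z = ennreal (max 0 z)" for z
      by (simp add: max_def ennreal_neg)
    have p: "ennreal a + (ennreal b + ennreal c) = ennreal (max 0 a + (max 0 b + max 0 c))" for a b c
      by (subst (1 2 3) m) (simp add: ennreal_plus)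
    show ?thesis
      unfolding p by (rule arg_cong[where f=ennreal]) (auto simp: max_def)
  qed
  show ?thesis
    using assms * by (cases a; cases b) auto
qed

text \<open>Finite subtracted terms rule out \<infinity> - \<infinity>, while \<open>a\<close> and
  \<open>b\<close>, which stand for positive parts, may be infinite.\<close>

lemma enn2ereal_diff_add:
  fixes a b c d :: ennreal
  assumes "c \<noteq> \<infinity>" "d \<noteq> \<infinity>"
  shows "enn2ereal (a + b) - enn2ereal (c + d) =
         (enn2ereal a - enn2ereal c) + (enn2ereal b - enn2ereal d)"
  using assms
  by (cases a; cases b; cases c; cases d) (auto simp: ennreal_plus[symmetric] simp del: ennreal_plus)

text \<open>The finite terms \<open>b\<close> and \<open>d\<close> can be moved across the equation.
  This returns from a subtraction-free identity to differences in \<open>ereal\<close>.\<close>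

lemma enn2ereal_diff_eqI:
  fixes a b c d :: ennreal
  assumes "a + d = b + c" "b \<noteq> \<infinity>" "d \<noteq> \<infinity>"
  shows "enn2ereal a - enn2ereal b = enn2ereal c - enn2ereal d"
  using assms
  by (cases a; cases b; cases c; cases d) (auto simp: ennreal_plus[symmetric] simp del: ennreal_plus)

text \<open>It bounds the negative part of an \<open>ereal_integral\<close> by the integral of the
  negative part. If both terms are infinite, the difference is \<infinity> and its negative part
  vanishes.\<close>

lemma e2ennreal_uminus_diff_le: "e2ennreal (- (enn2ereal a - enn2ereal b)) \<le> b"
  by (cases a; cases b) (auto simp: ennreal_leI e2ennreal_neg)

lemma ereal_integral_cong_AE:
  assumes "AE x in M. f x = g x"
  shows "ereal_integral M f = ereal_integral M g"
  unfolding ereal_integral_def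
  by (intro arg_cong2[where f="(-)"] arg_cong[where f=enn2ereal] nn_integral_cong_AE)
    (use assms in \<open>auto elim: eventually_mono\<close>)

text \<open>Finite integrals of the negative parts exclude the value -\<infinity> almost everywhere,
  so \<open>e2ennreal_add_parts\<close> can be integrated. The negative part of the sum has finite
  integral by subadditivity, hence all subtracted terms cancel legitimately. The integrals of the
  positive parts may be infinite.\<close>

lemma ereal_integral_add:
  assumes [measurable]: "f \<in> borel_measurable M" "g \<in> borel_measurable M"
    and f: "(\<integral>\<^sup>+x. e2ennreal (- f x) \<partial>M) \<noteq> \<infinity>" and g: "(\<integral>\<^sup>+x. e2ennreal (- g x) \<partial>M) \<noteq> \<infinity>"
  shows "ereal_integral M (\<lambda>x. f x + g x) = ereal_integral M f + ereal_integral M g"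
proof -
  have inf: "AE x in M. f x \<noteq> -\<infinity> \<and> g x \<noteq> -\<infinity>"
  proof -
    have "AE x in M. e2ennreal (- f x) \<noteq> \<infinity>" "AE x in M. e2ennreal (- g x) \<noteq> \<infinity>"
      by (intro nn_integral_PInf_AE; use f g in simp)+
    then show ?thesis by eventually_elim auto
  qed
  let ?P = "\<lambda>h. \<integral>\<^sup>+x. e2ennreal (h x) \<partial>M"
  have eq: "?P (\<lambda>x. f x + g x) + (?P (\<lambda>x. - f x) + ?P (\<lambda>x. - g x)) =
        ?P (\<lambda>x. - (f x + g x)) + (?P f + ?P g)"
    by (simp flip: nn_integral_add, rule nn_integral_cong_AE)
      (use inf in eventually_elim, use e2ennreal_add_parts in auto)
  have "?P (\<lambda>x. - (f x + g x)) \<le> ?P (\<lambda>x. - f x) + ?P (\<lambda>x. - g x)"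
  proof (subst nn_integral_add[symmetric], simp, simp, rule nn_integral_mono_AE, use inf in eventually_elim)
    fix x assume "f x \<noteq> -\<infinity> \<and> g x \<noteq> -\<infinity>"
    then show "e2ennreal (- (f x + g x)) \<le> e2ennreal (- f x) + e2ennreal (- g x)"
      using ennreal_add_le[of "- real_of_ereal (f x)" "- real_of_ereal (g x)"]
      by (cases "f x"; cases "g x") (simp_all add: e2ennreal_neg)
  qed
  then have "?P (\<lambda>x. - (f x + g x)) \<noteq> \<infinity>"
    using f g by (auto simp: top_unique)
  then show ?thesis
    unfolding ereal_integral_def using f g
    by (subst enn2ereal_diff_eqI[OF eq]) (auto simp: enn2ereal_diff_add)
qed

text \<open>For positive u and v, log t \<le> t - 1 at t = v / u gives -u log(u / v) \<le> v - u
  \<le> v. In the remaining cases the value is 0 or \<infinity>, with no negative part.\<close>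

lemma log_ratio_neg_part_le:
  assumes "0 \<le> u" "0 \<le> v"
  shows "e2ennreal (- log_ratio u v) \<le> ennreal v"
proof (cases "u = 0 \<or> v = 0")
  case True
  then show ?thesis by (auto simp: log_ratio_def e2ennreal_neg)
next
  case False
  then have "u > 0" "v > 0" using assms by auto
  then have "- (ln (u / v) * u) = ln (v / u) * u"
    by (simp add: ln_div algebra_simps)
  also have "\<dots> \<le> (v / u - 1) * u"
    using \<open>u > 0\<close> \<open>v > 0\<close> by (intro mult_right_mono ln_le_minus_one) auto
  also have "\<dots> \<le> v" using \<open>u > 0\<close> by (simp add: algebra_simps)
  finally show ?thesis using False by (auto simp: log_ratio_def intro!: ennreal_leI)
qed

lemma borel_measurable_log_ratio [measurable (raw)]:
  assumes [measurable]: "f \<in> borel_measurable M" "g \<in> borel_measurable M"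
  shows "(\<lambda>x. log_ratio (f x) (g x)) \<in> borel_measurable M"
  unfolding log_ratio_def by measurable

section \<open>Integrals and relative entropy for a Lebesgue density plus one atom\<close>

text \<open>Induction over nonnegative measurable \<open>h\<close>: for indicators it is the mass
  formula, and both terms respect sums, scalings and increasing limits. The congruence step compares
  functions only on the space, so the atom term there uses \<open>x \<in> S\<close>.\<close>

lemma nn_integral_dens_plus_atom:
  assumes f: "f \<in> borel_measurable (borel_on S)" and h: "h \<in> borel_measurable (borel_on S)"
    and x: "x \<in> S"
  shows "(\<integral>\<^sup>+y. h y \<partial>dens_plus_atom S f c x) = (\<integral>\<^sup>+y. f y * h y \<partial>leb_on S) + c * h x"
proof -
  let ?D = "dens_plus_atom S f c x"
  note ml = measurable_cong_sets[OF sets_leb_on refl]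
  note md = measurable_cong_sets[OF sets_dens_plus_atom refl]
  have sp: "space ?D = S" "space (leb_on S) = S" "space (borel_on S) = S"
    using sets_eq_imp_space_eq[OF sets_dens_plus_atom, of S f c x] by (simp_all add: space_restrict_space)
  have fl: "f \<in> borel_measurable (leb_on S)" using f by (simp add: ml)
  have times: "(\<lambda>y. f y * u y) \<in> borel_measurable (leb_on S)" if "u \<in> borel_measurable (borel_on S)" for u
    using borel_measurable_times_ennreal[of f "leb_on S" u] fl that by (simp add: ml)
  from h show ?thesis
  proof (induction rule: borel_measurable_induct)
    case (cong g h)
    have "(\<integral>\<^sup>+y. g y \<partial>?D) = (\<integral>\<^sup>+y. h y \<partial>?D)"
      using cong(3) sp by (intro nn_integral_cong) auto
    moreover have "(\<integral>\<^sup>+y. f y * g y \<partial>leb_on S) = (\<integral>\<^sup>+y. f y * h y \<partial>leb_on S)"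
      using cong(3) sp by (intro nn_integral_cong) auto
    moreover have "g x = h x"
      using cong(3) x sp by auto
    ultimately show ?case using cong(4) by simp
  next
    case (set A)
    then show ?case
      using emeasure_dens_plus_atom[OF f set] by (simp add: sets_dens_plus_atom)
  next
    case (mult u d)
    have "(\<integral>\<^sup>+y. f y * (d * u y) \<partial>leb_on S) = d * (\<integral>\<^sup>+y. f y * u y \<partial>leb_on S)"
      by (subst nn_integral_cmult[symmetric, OF times[OF mult(2)]]) (simp add: mult.left_commute)
    moreover have "(\<integral>\<^sup>+y. d * u y \<partial>?D) = d * (\<integral>\<^sup>+y. u y \<partial>?D)"
      by (intro nn_integral_cmult) (simp add: md mult)
    ultimately show ?case
      by (simp add: mult.IH distrib_left mult.left_commute)
  next
    case (add u v)
    have "(\<integral>\<^sup>+y. f y * (v y + u y) \<partial>leb_on S) =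
        (\<integral>\<^sup>+y. f y * v y \<partial>leb_on S) + (\<integral>\<^sup>+y. f y * u y \<partial>leb_on S)"
      by (subst nn_integral_add[symmetric, OF times[OF add.hyps(3)] times[OF add.hyps(1)]]) (simp add: distrib_left)
    moreover have "(\<integral>\<^sup>+y. v y + u y \<partial>?D) = (\<integral>\<^sup>+y. v y \<partial>?D) + (\<integral>\<^sup>+y. u y \<partial>?D)"
      by (intro nn_integral_add) (simp_all add: md add.hyps)
    ultimately show ?case
      by (simp add: add.IH distrib_left add_ac)
  next
    case (seq U)
    have mono: "U i y \<le> U k y" if "i \<le> k" for i k y
      using seq.hyps(3) that by (auto simp: incseq_def le_fun_def)
    then have i: "incseq (\<lambda>i y. f y * U i y)"
      by (auto simp: incseq_def le_fun_def intro!: mult_left_mono)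
    have "(\<integral>\<^sup>+y. (SUP i. U i) y \<partial>?D) = (SUP i. \<integral>\<^sup>+y. U i y \<partial>?D)"
      unfolding SUP_apply
      using seq.hyps(3) by (intro nn_integral_monotone_convergence_SUP) (simp_all add: md seq.hyps)
    also have "\<dots> = (SUP i. (\<integral>\<^sup>+y. f y * U i y \<partial>leb_on S) + c * U i x)"
      by (simp add: seq.IH)
    also have "\<dots> = (SUP i. \<integral>\<^sup>+y. f y * U i y \<partial>leb_on S) + (SUP i. c * U i x)"
      by (intro ennreal_SUP_add) (auto simp: incseq_def intro!: mult_left_mono nn_integral_mono mono)
    also have "(SUP i. \<integral>\<^sup>+y. f y * U i y \<partial>leb_on S) = (\<integral>\<^sup>+y. (SUP i. f y * U i y) \<partial>leb_on S)"
      using i by (intro nn_integral_monotone_convergence_SUP[symmetric]) (auto intro: times seq.hyps(1))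
    finally show ?case
      by (simp add: image_image SUP_mult_left_ennreal)
  qed
qed

lemma emeasure_leb_on_singleton:
  assumes "S \<in> sets borel" "x \<in> S"
  shows "emeasure (leb_on S) {x} = 0"
  using assms by (simp add: emeasure_restrict_space)

lemma sigma_finite_leb_on: "S \<in> sets borel \<Longrightarrow> sigma_finite_measure (leb_on S)"
  by (intro sigma_finite_measure_restrict_space sigma_finite_lborel) simp

lemma AE_leb_on_neq:
  assumes "S \<in> sets borel" "x \<in> S"
  shows "AE y in leb_on S. y \<noteq> x"
proof (rule AE_I')
  show "{x} \<in> null_sets (leb_on S)"
    using assms emeasure_leb_on_singleton[OF assms] by (auto simp: null_sets_def sets_restrict_space_iff)
qed auto

text \<open>Absolute continuity is assumed for the Lebesgue parts alone, so it can still fail at the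
  atom, which gives the case split. Otherwise the positive and negative parts of the logarithmic
  density are split separately by \<open>nn_integral_dens_plus_atom\<close>. The assumption
  \<open>fin\<close> makes the negative Lebesgue part finite, so the two differences
  recombine.\<close>

lemma rel_entropy_dens_plus_atom:
  fixes u v :: "'a::euclidean_space \<Rightarrow> real"
  assumes S: "S \<in> sets borel" and x: "x \<in> S"
    and u: "u \<in> borel_measurable (borel_on S)" and v: "v \<in> borel_measurable (borel_on S)"
    and nonneg: "\<And>y. y \<in> S \<Longrightarrow> 0 \<le> u y" "\<And>y. y \<in> S \<Longrightarrow> 0 \<le> v y" "0 \<le> s" "0 \<le> t"
    and fin: "(\<integral>\<^sup>+y. ennreal (v y) \<partial>leb_on S) \<noteq> \<infinity>"
    and ac: "absolutely_continuous (density (leb_on S) (\<lambda>y. ennreal (v y)))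
               (density (leb_on S) (\<lambda>y. ennreal (u y)))"
  shows "rel_entropy (dens_plus_atom S (\<lambda>y. ennreal (u y)) (ennreal s) x)
           (dens_plus_atom S (\<lambda>y. ennreal (v y)) (ennreal t) x) =
         ereal_integral (leb_on S) (\<lambda>y. log_ratio (u y) (v y)) + log_ratio s t"
proof -
  let ?L = "leb_on S"
  let ?Q = "dens_plus_atom S (\<lambda>y. ennreal (u y)) (ennreal s) x"
  let ?K = "dens_plus_atom S (\<lambda>y. ennreal (v y)) (ennreal t) x"
  note ml = measurable_cong_sets[OF sets_leb_on refl]
  have [measurable]: "u \<in> borel_measurable ?L" "v \<in> borel_measurable ?L"
    using u v by (simp_all add: ml)
  have eu: "(\<lambda>y. ennreal (u y)) \<in> borel_measurable (borel_on S)"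
    and ev: "(\<lambda>y. ennreal (v y)) \<in> borel_measurable (borel_on S)"
    using u v by measurable
  have spL: "space ?L = S" by (simp add: space_restrict_space)
  have xS: "{x} \<in> sets (borel_on S)"
    using S x by (auto simp: sets_restrict_space_iff)
  have ne: "AE y in ?L. y \<noteq> x" by (rule AE_leb_on_neq[OF S x])
  have pos: "AE y in ?L. y \<in> S" using AE_space[of ?L] by (simp add: spL)
  \<comment> \<open>The set where v = 0 is null for v dy, hence for u dy. Therefore v * (u / v) = u
    almost everywhere, even with division by zero yielding 0.\<close>
  have zero: "AE y in ?L. v y = 0 \<longrightarrow> u y = 0"
  proof -
    have N: "{y \<in> space ?L. v y = 0} \<in> sets ?L" by measurable
    have "{y \<in> space ?L. v y = 0} \<in> null_sets (density ?L (\<lambda>y. ennreal (v y)))"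
      using N by (subst null_sets_density_iff) (auto intro!: AE_I2)
    then have "{y \<in> space ?L. v y = 0} \<in> null_sets (density ?L (\<lambda>y. ennreal (u y)))"
      using ac by (auto simp: absolutely_continuous_def)
    then have "AE y in ?L. y \<in> {y \<in> space ?L. v y = 0} \<longrightarrow> ennreal (u y) = 0"
      by (subst (asm) null_sets_density_iff) auto
    with AE_space show ?thesis
      by eventually_elim (use nonneg spL in auto)
  qed
  have Nfin: "(\<integral>\<^sup>+y. e2ennreal (- log_ratio (u y) (v y)) \<partial>?L) \<noteq> \<infinity>"
  proof -
    have "(\<integral>\<^sup>+y. e2ennreal (- log_ratio (u y) (v y)) \<partial>?L) \<le> (\<integral>\<^sup>+y. ennreal (v y) \<partial>?L)"
      by (intro nn_integral_mono log_ratio_neg_part_le) (use nonneg spL in auto)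
    then show ?thesis using fin by (auto simp: top_unique)
  qed
  show ?thesis
  proof (cases "t = 0 \<and> s \<noteq> 0")
    \<comment> \<open>The singleton {x} is Lebesgue null, so its mass is t = 0 under
      \<open>?K\<close> and s > 0 under \<open>?Q\<close>. On the right the atom term is
      \<infinity>, and the Lebesgue term is not -\<infinity>.\<close>
    case True
    have "?L {x} = 0"
      by (rule emeasure_leb_on_singleton[OF S x])
    then have z: "(\<integral>\<^sup>+y\<in>{x}. f y \<partial>?L) = 0" for f :: "'a \<Rightarrow> ennreal"
    proof -
      have "(\<integral>\<^sup>+y\<in>{x}. f y \<partial>?L) = (\<integral>\<^sup>+y. 0 \<partial>?L)"
        by (rule nn_integral_cong_AE, use ne in eventually_elim) auto
      then show ?thesis by simp
    qed
    have "{x} \<in> null_sets ?K"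
      using True xS by (simp add: null_sets_def sets_dens_plus_atom emeasure_dens_plus_atom[OF ev xS] z)
    moreover have "{x} \<notin> null_sets ?Q"
      using True nonneg by (simp add: null_sets_def emeasure_dens_plus_atom[OF eu xS] z)
    ultimately have "rel_entropy ?Q ?K = \<infinity>"
      by (auto simp: rel_entropy_def absolutely_continuous_def)
    moreover have "ereal_integral ?L (\<lambda>y. log_ratio (u y) (v y)) \<noteq> -\<infinity>"
    proof -
      have "enn2ereal a - enn2ereal b \<noteq> -\<infinity>" if "b \<noteq> \<infinity>" for a b
        using that by (cases a; cases b) auto
      then show ?thesis unfolding ereal_integral_def using Nfin by blast
    qed
    ultimately show ?thesis using True by (simp add: log_ratio_def)
  next
    case False
    \<comment> \<open>The candidate for dQ/dK: changing it at the single point x is invisible to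
      Lebesgue measure and carries the whole atom. Here t = 0 forces s = 0, so t * (s / t) =
      s.\<close>
    define g where "g y = (if y = x then s / t else u y / v y)" for y
    have [measurable]: "g \<in> borel_measurable (borel_on S)"
    proof -
      have [measurable]: "{y \<in> space (borel_on S). y = x} \<in> sets (borel_on S)"
        using xS x by (auto simp: space_restrict_space Collect_conv_if)
      note [measurable] = u v
      show ?thesis unfolding g_def by measurable
    qed
    have gK [measurable]: "g \<in> borel_measurable ?K" "g \<in> borel_measurable ?Q" 
      by (simp_all add: measurable_cong_sets[OF sets_dens_plus_atom refl])
    have ug: "AE y in ?L. y \<in> S \<and> g y = u y / v y \<and> (v y = 0 \<longrightarrow> u y = 0)"
      using ne pos zero by eventually_elim (auto simp: g_def)
    have gx: "g x = s / t" by (simp add: g_def)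
    have gnn: "0 \<le> g y" if "y \<in> S" for y
      using nonneg that by (auto simp: g_def)
    have dens: "density ?K (\<lambda>y. ennreal (g y)) = ?Q"
    proof (rule measure_eqI)
      fix A assume "A \<in> sets (density ?K (\<lambda>y. ennreal (g y)))"
      then have A [measurable]: "A \<in> sets (borel_on S)" by (simp add: sets_dens_plus_atom)
      have "emeasure (density ?K (\<lambda>y. ennreal (g y))) A = (\<integral>\<^sup>+y. ennreal (g y) * indicator A y \<partial>?K)"
        by (rule emeasure_density) (use A in \<open>simp_all add: sets_dens_plus_atom\<close>)
      also have "\<dots> = (\<integral>\<^sup>+y. ennreal (v y) * (ennreal (g y) * indicator A y) \<partial>?L)
          + ennreal t * (ennreal (g x) * indicator A x)"
        by (intro nn_integral_dens_plus_atom ev x) measurable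
      also have "(\<integral>\<^sup>+y. ennreal (v y) * (ennreal (g y) * indicator A y) \<partial>?L) =
          (\<integral>\<^sup>+y\<in>A. ennreal (u y) \<partial>?L)"
        by (rule nn_integral_cong_AE, use ug in eventually_elim)
          (use nonneg in \<open>auto simp: indicator_def ennreal_mult[symmetric]\<close>)
      also have "ennreal t * (ennreal (g x) * indicator A x) = ennreal s * indicator A x"
        using False nonneg by (auto simp: gx indicator_def ennreal_mult[symmetric])
      also have "(\<integral>\<^sup>+y\<in>A. ennreal (u y) \<partial>?L) + ennreal s * indicator A x = emeasure ?Q A"
        by (rule emeasure_dens_plus_atom[OF eu A, symmetric])
      finally show "emeasure (density ?K (\<lambda>y. ennreal (g y))) A = emeasure ?Q A" .
    qed (simp add: sets_dens_plus_atom)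
    have acQ: "absolutely_continuous ?K ?Q"
      unfolding dens[symmetric] by (rule absolutely_continuousI_density) simp
    interpret K: finite_measure ?K
    proof
      have sp: "space ?K \<in> sets (borel_on S)"
        by (metis sets.top sets_dens_plus_atom)
      have "(\<integral>\<^sup>+y\<in>space ?K. ennreal (v y) \<partial>?L) \<le> (\<integral>\<^sup>+y. ennreal (v y) \<partial>?L)"
        by (intro nn_integral_mono) (auto simp: indicator_def)
      then show "emeasure ?K (space ?K) \<noteq> \<infinity>"
        using fin by (auto simp: emeasure_dens_plus_atom[OF ev sp] top_unique indicator_def)
    qed
    have "AE y in ?K. ennreal (g y) = RN_deriv ?K ?Q y"
      by (rule K.RN_deriv_unique[OF _ dens]) simp
    \<comment> \<open>Uniqueness of the derivative holds \<open>?K\<close>-almost everywhere,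
      whereas the entropy integrates against \<open>?Q\<close>; absolute continuity transfers the
      null set.\<close>
    then have "AE y in ?Q. ennreal (g y) = RN_deriv ?K ?Q y"
      using acQ by (intro absolutely_continuous_AE[of ?Q ?K]) (simp_all add: sets_dens_plus_atom)
    then have ed: "AE y in ?Q. ereal (entropy_density (exp 1) ?K ?Q y) = ereal (ln (g y))"
      using AE_space[of ?Q]
    proof eventually_elim
      case (elim y)
      then have "y \<in> S"
        using sets_eq_imp_space_eq[OF sets_dens_plus_atom, of S _ _ x] by (simp add: space_restrict_space)
      then have "enn2real (RN_deriv ?K ?Q y) = g y"
        using elim gnn by (metis enn2real_ennreal)
      then show ?case by (simp add: entropy_density_def log_def)
    qed
    \<comment> \<open>A nonnegative weight commutes with taking positive and negative parts. At a =
      0 both sides vanish by the convention in \<open>log_ratio\<close>.\<close>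
    have lg: "ennreal a * e2ennreal (ereal (ln (a / b))) = e2ennreal (log_ratio a b)"
      "ennreal a * e2ennreal (- ereal (ln (a / b))) = e2ennreal (- log_ratio a b)"
      if "0 \<le> a" "b = 0 \<longrightarrow> a = 0" for a b
    proof -
      have "ennreal a * ennreal l = ennreal (l * a)" for l
        using that(1) by (subst ennreal_mult'') (simp_all add: mult.commute)
      from this[of "ln (a / b)"] this[of "- ln (a / b)"] that(2)
      show "ennreal a * e2ennreal (ereal (ln (a / b))) = e2ennreal (log_ratio a b)"
        "ennreal a * e2ennreal (- ereal (ln (a / b))) = e2ennreal (- log_ratio a b)"
        by (auto simp: log_ratio_def e2ennreal_neg)
    qed
    have p: "(\<integral>\<^sup>+y. e2ennreal (ereal (ln (g y))) \<partial>?Q) =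
        (\<integral>\<^sup>+y. e2ennreal (log_ratio (u y) (v y)) \<partial>?L) + e2ennreal (log_ratio s t)"
    proof -
      have "(\<integral>\<^sup>+y. e2ennreal (ereal (ln (g y))) \<partial>?Q) =
        (\<integral>\<^sup>+y. ennreal (u y) * e2ennreal (ereal (ln (g y))) \<partial>?L) + ennreal s * e2ennreal (ereal (ln (g x)))"
        by (intro nn_integral_dens_plus_atom eu x) measurable
      also have "(\<integral>\<^sup>+y. ennreal (u y) * e2ennreal (ereal (ln (g y))) \<partial>?L) =
          (\<integral>\<^sup>+y. e2ennreal (log_ratio (u y) (v y)) \<partial>?L)"
        by (rule nn_integral_cong_AE, use ug in eventually_elim) (use nonneg lg in metis)
      finally show ?thesis unfolding gx by (subst lg(1)[symmetric]) (use False nonneg in auto)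
    qed
    have n: "(\<integral>\<^sup>+y. e2ennreal (- ereal (ln (g y))) \<partial>?Q) =
        (\<integral>\<^sup>+y. e2ennreal (- log_ratio (u y) (v y)) \<partial>?L) + e2ennreal (- log_ratio s t)"
    proof -
      have "(\<integral>\<^sup>+y. e2ennreal (- ereal (ln (g y))) \<partial>?Q) =
        (\<integral>\<^sup>+y. ennreal (u y) * e2ennreal (- ereal (ln (g y))) \<partial>?L) + ennreal s * e2ennreal (- ereal (ln (g x)))"
        by (intro nn_integral_dens_plus_atom eu x) measurable
      also have "(\<integral>\<^sup>+y. ennreal (u y) * e2ennreal (- ereal (ln (g y))) \<partial>?L) =
          (\<integral>\<^sup>+y. e2ennreal (- log_ratio (u y) (v y)) \<partial>?L)"
        by (rule nn_integral_cong_AE, use ug in eventually_elim) (use nonneg lg in metis)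
      finally show ?thesis unfolding gx by (subst lg(2)[symmetric]) (use False nonneg in auto)
    qed
    \<comment> \<open>Either s = 0 or t > 0 in this case, so the atom term is a real number and its
      negative part is finite.\<close>
    obtain l where l: "log_ratio s t = ereal l"
    proof (rule that)
      show "log_ratio s t = ereal (ln (s / t) * s)"
        using False by (auto simp: log_ratio_def)
    qed
    have "rel_entropy ?Q ?K = ereal_integral ?Q (\<lambda>y. ereal (ln (g y)))"
      using acQ ereal_integral_cong_AE[OF ed] by (simp add: rel_entropy_def)
    also have "\<dots> = ereal_integral ?L (\<lambda>y. log_ratio (u y) (v y)) + log_ratio s t"
    proof -
      have "enn2ereal (ennreal l) - enn2ereal (ennreal (- l)) = ereal l"
        by (cases "0 \<le> l") (auto simp: ennreal_neg zero_ennreal.rep_eq)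
      then show ?thesis
        unfolding ereal_integral_def p n using Nfin
        by (subst enn2ereal_diff_add) (auto simp: l)
    qed
    finally show ?thesis .
  qed
qed

section \<open>Borel structure of \<open>S\<close> and a jointly measurable version of the
  off-diagonal density\<close>

text \<open>Finite intersections of a countable basis are still countable and form a \<pi>-system;
  the empty intersection contributes the whole space, hence \<open>S\<close> after the trace.
  Countability allows the null sets attached to single generators to be united.\<close>

lemma borel_on_countable_generator:
  fixes S :: "'a::second_countable_topology set"
  assumes "S \<in> sets borel"
  obtains G where "countable G" "Int_stable G" "G \<subseteq> Pow S" "S \<in> G"
    "sets (borel_on S) = sigma_sets S G"
proof -
  obtain B :: "'a set set" where B: "countable B" "topological_basis B"
    using ex_countable_basis by blast
  define B1 where "B1 = Inter ` {F. finite F \<and> F \<subseteq> B}"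
  have c: "countable B1"
    unfolding B1_def using B(1) by (intro countable_image countable_Collect_finite_subset)
  have op: "open A" if "A \<in> B1" for A
    using that topological_basis_open[OF B(2)] by (auto simp: B1_def intro!: open_Inter)
  have sub: "B \<subseteq> B1"
  proof
    fix b assume "b \<in> B"
    then show "b \<in> B1" by (auto simp: B1_def intro!: image_eqI[of _ _ "{b}"])
  qed
  have "topological_basis B1"
    using B(2) op sub unfolding topological_basis_def by (metis subset_trans)
  then have b: "borel = sigma UNIV B1"
    by (rule borel_eq_countable_basis[OF c])
  have U: "UNIV \<in> B1" by (auto simp: B1_def intro!: image_eqI[of _ _ "{}"])
  have I: "P \<inter> Q \<in> B1" if PQ: "P \<in> B1" "Q \<in> B1" for P Q
  proof -
    obtain F H where "finite F" "F \<subseteq> B" "P = \<Inter>F" "finite H" "H \<subseteq> B" "Q = \<Inter>H"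
      using PQ by (auto simp: B1_def)
    then show ?thesis by (auto simp: B1_def intro!: image_eqI[of _ _ "F \<union> H"])
  qed
  show ?thesis
  proof (rule that)
    show "countable ((\<inter>) S ` B1)" using c by simp
    show "Int_stable ((\<inter>) S ` B1)"
    proof (rule Int_stableI)
      fix a b assume "a \<in> (\<inter>) S ` B1" "b \<in> (\<inter>) S ` B1"
      then obtain P Q where "P \<in> B1" "Q \<in> B1" "a = S \<inter> P" "b = S \<inter> Q" by auto
      then show "a \<inter> b \<in> (\<inter>) S ` B1" using I by (auto intro!: image_eqI[of _ _ "P \<inter> Q"])
    qed
    show "(\<inter>) S ` B1 \<subseteq> Pow S" by auto
    show "S \<in> (\<inter>) S ` B1" using U by force
    have "sets (borel_on S) = (\<inter>) S ` sigma_sets UNIV B1"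
      unfolding b by (simp add: sets_restrict_space)
    also have "\<dots> = sigma_sets S ((\<inter>) S ` B1)"
      using assms by (intro sigma_sets_Int) (auto simp: b)
    finally show "sets (borel_on S) = sigma_sets S ((\<inter>) S ` B1)" .
  qed
qed

text \<open>A completely metrizable subspace of a metric space is a countable intersection of open
  sets. If that family is empty, \<open>S\<close> is the whole space.\<close>

lemma polish_subset_borel:
  fixes S :: "'a::metric_space set"
  assumes "polish_subset S"
  shows "S \<in> sets borel"
proof -
  have "gdelta_in euclidean S"
    using assms by (intro completely_metrizable_space_imp_gdelta_in)
      (auto simp: polish_subset_def metrizable_space_euclidean)
  then obtain U where "countable U" "U \<subseteq> Collect open" "\<Inter>U = S"
    by (auto simp: gdelta_in_alt intersection_of_def)
  then show ?thesis
    by (cases "U = {}") (auto intro!: sets.countable_INT'[of U "\<lambda>x. x", simplified])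
qed

text \<open>By second countability the product of the Borel \<sigma>-algebras is the Borel
  \<sigma>-algebra of the product, so the inclusion into \<open>S \<times> S\<close> is
  measurable.\<close>

lemma continuous_on_pair_measurable:
  fixes S :: "'a::second_countable_topology set" and f :: "'a \<times> 'a \<Rightarrow> 'b::topological_space"
  assumes "continuous_on (S \<times> S) f"
  shows "f \<in> borel_measurable (borel_on S \<Otimes>\<^sub>M borel_on S)"
proof -
  have "(\<lambda>z. (fst z, snd z)) \<in> borel_on S \<Otimes>\<^sub>M borel_on S \<rightarrow>\<^sub>M (borel \<Otimes>\<^sub>M borel)"
    by (intro measurable_Pair measurable_compose[OF measurable_fst] measurable_compose[OF measurable_snd]
        measurable_restrict_space1 measurable_ident_sets[OF refl])
  then have "(\<lambda>z. z) \<in> borel_on S \<Otimes>\<^sub>M borel_on S \<rightarrow>\<^sub>M restrict_space borel (S \<times> S)"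
    by (intro measurable_restrict_space2) (auto simp: space_pair_measure space_restrict_space borel_prod)
  from measurable_compose[OF this borel_measurable_continuous_on_restrict[OF assms]]
  show ?thesis .
qed


text \<open>The densities \<open>\<alpha> x\<close> are measurable only for each \<open>x\<close> separately. A jointly measurable version is
  the Radon--Nikodym derivative of the off-diagonal part of \<open>\<nu>(dx) q(x, dy)\<close> with respect to
  \<open>\<nu>(dx) dy\<close>; a countable generator of the Borel sets makes the exceptional null set uniform.\<close>

lemma jointly_measurable_density:
  fixes S :: "'a::euclidean_space set"
    and \<alpha> :: "'a \<Rightarrow> 'a \<Rightarrow> ennreal" and \<rho> :: "'a \<Rightarrow> ennreal"
  assumes S: "S \<in> sets borel"
    and \<nu>: "\<nu> \<in> space (prob_algebra (borel_on S))"
    and q: "q \<in> borel_on S \<rightarrow>\<^sub>M prob_algebra (borel_on S)"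
    and eq: "AE x in \<nu>. \<alpha> x \<in> borel_measurable (borel_on S) \<and> q x = dens_plus_atom S (\<alpha> x) (\<rho> x) x"
  obtains f where "f \<in> borel_measurable (borel_on S \<Otimes>\<^sub>M borel_on S)"
    "AE x in \<nu>. AE y in leb_on S. f (x, y) = \<alpha> x y"
proof -
  let ?B = "borel_on S" and ?L = "leb_on S"
  have sets_\<nu>: "sets \<nu> = sets ?B" and "prob_space \<nu>"
    using \<nu> by (auto simp: space_prob_algebra)
  interpret \<nu>: prob_space \<nu> by fact
  interpret L: sigma_finite_measure ?L by (rule sigma_finite_leb_on[OF S])
  interpret NL: pair_sigma_finite \<nu> ?L ..
  note m\<nu> = measurable_cong_sets[OF sets_\<nu> refl]
  note mL = measurable_cong_sets[OF sets_leb_on refl]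
  have sp: "space ?B = S" "space ?L = S" "space \<nu> = S"
    using sets_eq_imp_space_eq[OF sets_\<nu>] by (auto simp: space_restrict_space)
  have sets_N: "sets (\<nu> \<Otimes>\<^sub>M ?L) = sets (?B \<Otimes>\<^sub>M ?B)"
    by (intro sets_pair_measure_cong sets_\<nu> sets_leb_on)
  note mN = measurable_cong_sets[OF sets_N refl]
  have qs: "q \<in> ?B \<rightarrow>\<^sub>M subprob_algebra ?B"
    using q by (rule measurable_prob_algebraD)
  have sq: "sets (q x) = sets ?B" "space (q x) = S" if "x \<in> S" for x
    using measurable_space[OF q, of x] that sp sets_eq_imp_space_eq[of "q x" ?B]
    by (auto simp: space_prob_algebra)
  have xS: "AE x in \<nu>. x \<in> S" using AE_space[of \<nu>] by (simp add: sp)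

  \<comment> \<open>The off-diagonal indicator: as a factor it removes the atom of q(x, dy) and
    leaves Lebesgue integrals in y unchanged.\<close>
  define D :: "'a \<times> 'a \<Rightarrow> ennreal" where "D z = (if fst z = snd z then 0 else 1)" for z
  have D: "D \<in> borel_measurable (?B \<Otimes>\<^sub>M ?B)"
  proof -
    have i: "(\<lambda>x. x) \<in> borel_measurable ?B"
      by (intro measurable_restrict_space1 measurable_ident_sets[OF refl])
    note [measurable] = measurable_compose[OF measurable_fst i] measurable_compose[OF measurable_snd i]
    show ?thesis unfolding D_def by measurable
  qed
  \<comment> \<open>The measure comes from the measurable kernel \<open>q\<close>, so its
    construction does not presuppose joint measurability of \<alpha>.\<close>
  define M where "M = density (kernel_prod S \<nu> q) D"
  have kp: "(\<lambda>x. distr (q x) (?B \<Otimes>\<^sub>M ?B) (Pair x)) \<in> \<nu> \<rightarrow>\<^sub>M subprob_algebra (?B \<Otimes>\<^sub>M ?B)"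
    unfolding m\<nu> by (rule measurable_distr2[OF _ qs]) measurable
  have sets_kp: "sets (kernel_prod S \<nu> q) = sets (?B \<Otimes>\<^sub>M ?B)"
    unfolding kernel_prod_def
    by (rule sets_bind[OF sets_kernel[OF kp]]) (simp_all add: \<nu>.not_empty)
  have sets_M: "sets M = sets (?B \<Otimes>\<^sub>M ?B)" by (simp add: M_def sets_kp)
  have off: "AE x in \<nu>. (\<integral>\<^sup>+y. D (x, y) * h (x, y) \<partial>q x) = (\<integral>\<^sup>+y. \<alpha> x y * h (x, y) \<partial>?L)"
    if h: "h \<in> borel_measurable (?B \<Otimes>\<^sub>M ?B)" for h
    using eq xS
  proof eventually_elim
    case (elim x)
    have h1: "(\<lambda>y. D (x, y)) \<in> borel_measurable ?B" "(\<lambda>y. h (x, y)) \<in> borel_measurable ?B"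
      by (rule measurable_Pair2[OF D] measurable_Pair2[OF h], use elim sp in simp)+
    have "(\<integral>\<^sup>+y. D (x, y) * h (x, y) \<partial>q x) =
        (\<integral>\<^sup>+y. \<alpha> x y * (D (x, y) * h (x, y)) \<partial>?L) + \<rho> x * (D (x, x) * h (x, x))"
      using elim h1 by (simp add: nn_integral_dens_plus_atom)
    also have "D (x, x) = 0" by (simp add: D_def)
    also have "(\<integral>\<^sup>+y. \<alpha> x y * (D (x, y) * h (x, y)) \<partial>?L) = (\<integral>\<^sup>+y. \<alpha> x y * h (x, y) \<partial>?L)"
      by (rule nn_integral_cong_AE, use AE_leb_on_neq[OF S, of x] elim in \<open>auto simp: D_def elim!: eventually_mono\<close>)
    finally show ?case by simp
  qed
  have M: "emeasure M C = (\<integral>\<^sup>+x. \<integral>\<^sup>+y. D (x, y) * indicator C (x, y) \<partial>q x \<partial>\<nu>)"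
    if C: "C \<in> sets (?B \<Otimes>\<^sub>M ?B)" for C
  proof -
    have DC: "(\<lambda>z. D z * indicator C z) \<in> borel_measurable (?B \<Otimes>\<^sub>M ?B)"
      using D C by measurable
    have "emeasure M C = (\<integral>\<^sup>+z. D z * indicator C z \<partial>kernel_prod S \<nu> q)"
      unfolding M_def using C D
      by (intro emeasure_density) (simp_all add: sets_kp measurable_cong_sets[OF sets_kp refl])
    also have "\<dots> = (\<integral>\<^sup>+x. \<integral>\<^sup>+z. D z * indicator C z \<partial>distr (q x) (?B \<Otimes>\<^sub>M ?B) (Pair x) \<partial>\<nu>)"
      unfolding kernel_prod_def by (rule nn_integral_bind[OF DC kp])
    also have "\<dots> = (\<integral>\<^sup>+x. \<integral>\<^sup>+y. D (x, y) * indicator C (x, y) \<partial>q x \<partial>\<nu>)"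
      by (intro nn_integral_cong nn_integral_distr)
        (auto simp: sp sq DC measurable_cong_sets[OF sq(1) refl])
    finally show ?thesis .
  qed
  \<comment> \<open>Since \<alpha> is not known to be jointly measurable, this is an
    almost-everywhere rewriting of the formula with \<open>q\<close>, not an application of Fubini's
    theorem.\<close>
  have M': "emeasure M C = (\<integral>\<^sup>+x. \<integral>\<^sup>+y. \<alpha> x y * indicator C (x, y) \<partial>?L \<partial>\<nu>)"
    if C: "C \<in> sets (?B \<Otimes>\<^sub>M ?B)" for C
    unfolding M[OF C] by (rule nn_integral_cong_AE, rule off) (use C in measurable)
  \<comment> \<open>Almost every section of a null set of the product is Lebesgue null, so the
    integral of \<alpha> over it vanishes.\<close>
  have "absolutely_continuous (\<nu> \<Otimes>\<^sub>M ?L) M"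
    unfolding absolutely_continuous_def
  proof
    fix C assume C: "C \<in> null_sets (\<nu> \<Otimes>\<^sub>M ?L)"
    then have C': "C \<in> sets (?B \<Otimes>\<^sub>M ?B)" by (auto simp: sets_N dest: null_setsD2)
    have "AE z in \<nu> \<Otimes>\<^sub>M ?L. z \<notin> C" using C by (rule AE_not_in)
    then have "AE x in \<nu>. AE y in ?L. (x, y) \<notin> C" by (rule NL.AE_pair)
    then have "AE x in \<nu>. (\<integral>\<^sup>+y. \<alpha> x y * indicator C (x, y) \<partial>?L) = 0"
    proof eventually_elim
      case (elim x)
      have "(\<integral>\<^sup>+y. \<alpha> x y * indicator C (x, y) \<partial>?L) = (\<integral>\<^sup>+y. 0 \<partial>?L)"
        by (rule nn_integral_cong_AE, use elim in eventually_elim) auto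
      then show ?case by simp
    qed
    then have "emeasure M C = (\<integral>\<^sup>+x. 0 \<partial>\<nu>)"
      unfolding M'[OF C'] by (rule nn_integral_cong_AE)
    then show "C \<in> null_sets M" using C' by (simp add: null_sets_def sets_M)
  qed
  define f where "f = RN_deriv (\<nu> \<Otimes>\<^sub>M ?L) M"
  have f [measurable]: "f \<in> borel_measurable (\<nu> \<Otimes>\<^sub>M ?L)" by (simp add: f_def)
  have dM: "density (\<nu> \<Otimes>\<^sub>M ?L) f = M"
    unfolding f_def by (rule NL.density_RN_deriv) (use \<open>absolutely_continuous _ M\<close> in \<open>simp_all add: sets_M sets_N\<close>)
  have AE_rect: "AE x in \<nu>. (\<integral>\<^sup>+y\<in>E. f (x, y) \<partial>?L) = (\<integral>\<^sup>+y\<in>E. \<alpha> x y \<partial>?L)"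
    if E: "E \<in> sets ?B" for E
  proof -
    have EL [measurable]: "E \<in> sets ?L" using E by (simp add: sets_leb_on)
    \<comment> \<open>A measurable stand-in for x \<mapsto> \<integral> \<alpha>(x, y) dy over E. It
      is compared with the integral of \<open>f\<close> as a density of A \<mapsto> M(A \<times> E)
      with respect to \<nu>.\<close>
    define v where "v x = (\<integral>\<^sup>+y. D (x, y) * indicator E y \<partial>q x)" for x
    have v [measurable]: "v \<in> borel_measurable \<nu>"
      unfolding m\<nu> v_def
      by (rule nn_integral_measurable_subprob_algebra2[OF _ qs])
        (use D E in \<open>simp add: case_prod_unfold; measurable\<close>)
    have "(\<lambda>z. indicator E (snd z) :: ennreal) \<in> borel_measurable (?B \<Otimes>\<^sub>M ?B)"
      using E by measurable
    from off[OF this] have v\<alpha>: "AE x in \<nu>. v x = (\<integral>\<^sup>+y\<in>E. \<alpha> x y \<partial>?L)"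
      by (simp add: v_def)
    have fE: "(\<lambda>x. \<integral>\<^sup>+y\<in>E. f (x, y) \<partial>?L) \<in> borel_measurable \<nu>"
      by (rule L.borel_measurable_nn_integral_fst[where f="\<lambda>z. f z * indicator E (snd z)", simplified]) measurable
    have "density \<nu> (\<lambda>x. \<integral>\<^sup>+y\<in>E. f (x, y) \<partial>?L) = density \<nu> v"
    proof (rule measure_eqI)
      fix A assume "A \<in> sets (density \<nu> (\<lambda>x. \<integral>\<^sup>+y\<in>E. f (x, y) \<partial>?L))"
      then have A [measurable]: "A \<in> sets \<nu>" by simp
      then have AE: "A \<times> E \<in> sets (?B \<Otimes>\<^sub>M ?B)" using E by (simp add: sets_\<nu>)
      have "emeasure (density \<nu> (\<lambda>x. \<integral>\<^sup>+y\<in>E. f (x, y) \<partial>?L)) A =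
          (\<integral>\<^sup>+x. (\<integral>\<^sup>+y\<in>E. f (x, y) \<partial>?L) * indicator A x \<partial>\<nu>)"
        by (rule emeasure_density[OF fE A])
      also have "\<dots> = (\<integral>\<^sup>+x. \<integral>\<^sup>+y. f (x, y) * indicator (A \<times> E) (x, y) \<partial>?L \<partial>\<nu>)"
        by (intro nn_integral_cong) (auto simp: indicator_def split: if_splits)
      also have "\<dots> = (\<integral>\<^sup>+z. f z * indicator (A \<times> E) z \<partial>(\<nu> \<Otimes>\<^sub>M ?L))"
        using AE by (intro L.nn_integral_fst borel_measurable_times_ennreal f borel_measurable_indicator) (simp add: sets_N)
      also have "\<dots> = emeasure M (A \<times> E)"
        unfolding dM[symmetric] using AE by (subst emeasure_density) (simp_all add: sets_N)
      also have "\<dots> = (\<integral>\<^sup>+x. \<integral>\<^sup>+y. D (x, y) * indicator (A \<times> E) (x, y) \<partial>q x \<partial>\<nu>)"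
        by (rule M[OF AE])
      also have "\<dots> = (\<integral>\<^sup>+x. v x * indicator A x \<partial>\<nu>)"
        unfolding v_def by (intro nn_integral_cong) (auto simp: indicator_def split: if_splits)
      also have "\<dots> = emeasure (density \<nu> v) A"
        by (rule emeasure_density[OF v A, symmetric])
      finally show "emeasure (density \<nu> (\<lambda>x. \<integral>\<^sup>+y\<in>E. f (x, y) \<partial>?L)) A = emeasure (density \<nu> v) A" .
    qed simp
    then have "AE x in \<nu>. (\<integral>\<^sup>+y\<in>E. f (x, y) \<partial>?L) = v x"
      by (rule \<nu>.density_unique[OF fE v])
    with v\<alpha> show ?thesis by eventually_elim simp
  qed
  obtain G where G: "countable G" "Int_stable G" "G \<subseteq> Pow S" "S \<in> G" "sets ?B = sigma_sets S G"
    using borel_on_countable_generator[OF S] .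
  have GB: "E \<in> sets ?B" if "E \<in> G" for E
    using that by (auto simp: G(5))
  \<comment> \<open>The exceptional set in \<open>AE_rect\<close> depends on E; for the countable
    generator these sets combine into one null set.\<close>
  have "AE x in \<nu>. \<forall>E\<in>G. (\<integral>\<^sup>+y\<in>E. f (x, y) \<partial>?L) = (\<integral>\<^sup>+y\<in>E. \<alpha> x y \<partial>?L)"
    using AE_rect GB by (simp add: AE_ball_countable[OF G(1)])
  then have "AE x in \<nu>. AE y in ?L. f (x, y) = \<alpha> x y"
    using eq xS
  proof eventually_elim
    case (elim x)
    have f1: "(\<lambda>y. f (x, y)) \<in> borel_measurable ?L"
      using elim sp by (intro measurable_Pair2[OF f]) blast
    have a1: "\<alpha> x \<in> borel_measurable ?L" using elim by (simp add: mL)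
    have e: "emeasure (density ?L (\<lambda>y. f (x, y))) E = emeasure (density ?L (\<alpha> x)) E" if "E \<in> G" for E
      using elim that f1 a1 GB[OF that] by (simp add: emeasure_density sets_leb_on)
    \<comment> \<open>The total mass is at most that of the probability measure \<open>q x\<close>.
      This finiteness lets agreement on the \<pi>-system extend to all Borel sets, with
      \<open>S\<close> as the exhausting sequence.\<close>
    have "emeasure (density ?L (\<alpha> x)) S \<le> emeasure (q x) S"
    proof -
      have SB: "S \<in> sets ?B" using GB G(4) by blast
      have "emeasure (q x) S = (\<integral>\<^sup>+y\<in>S. \<alpha> x y \<partial>?L) + \<rho> x * indicator S x"
        using elim emeasure_dens_plus_atom[OF _ SB] by metis
      then show ?thesis using a1 SB by (simp add: emeasure_density sets_leb_on)
    qed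
    also have "emeasure (q x) S = 1"
      using measurable_space[OF q, of x] elim sq(2)[of x] sp prob_space.emeasure_space_1[of "q x"]
      by (auto simp: space_prob_algebra)
    finally have fin: "emeasure (density ?L (\<lambda>y. f (x, y))) S \<noteq> \<infinity>"
      using e[OF G(4)] by (auto simp: top_unique)
    have "density ?L (\<lambda>y. f (x, y)) = density ?L (\<alpha> x)"
      by (rule measure_eqI_generator_eq[OF G(2,3) e, where A="\<lambda>_. S"])
        (use G(4,5) fin in \<open>simp_all add: sets_leb_on\<close>)
    then show ?case
      by (rule L.density_unique[OF f1 a1])
  qed
  then show ?thesis
    using f by (intro that[of f]) (simp_all add: mN)
qed


section \<open>The Metropolis-Hastings density and measurability in the parameter\<close>

lemma mh_a_nonneg:
  assumes "0 \<le> p x" "0 \<le> p y" "0 \<le> j x y" "0 \<le> j y x"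
  shows "0 \<le> mh_a p j x y"
  using assms by (simp add: mh_a_def mh_accept_def)

lemma mh_a_le:
  assumes "0 \<le> j x y"
  shows "mh_a p j x y \<le> j x y"
  using assms by (auto simp: mh_a_def mh_accept_def intro!: mult_left_le_one_le mult_right_le_one_le mult_left_mono)

lemma borel_measurable_mh_a:
  fixes S :: "'a::euclidean_space set"
  assumes p: "continuous_on S p" and j: "continuous_on (S \<times> S) (\<lambda>(x, y). j x y)"
  shows "(\<lambda>z. mh_a p j (fst z) (snd z)) \<in> borel_measurable (borel_on S \<Otimes>\<^sub>M borel_on S)"
proof -
  have p': "p \<in> borel_measurable (borel_on S)"
    by (rule borel_measurable_continuous_on_restrict[OF p])
  have j': "(\<lambda>z. j (fst z) (snd z)) \<in> borel_measurable (borel_on S \<Otimes>\<^sub>M borel_on S)"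
    using continuous_on_pair_measurable[OF j] by (simp add: case_prod_unfold)
  note [measurable] = j' measurable_compose[OF measurable_pair_swap' j', simplified case_prod_unfold fst_conv snd_conv]
    measurable_compose[OF measurable_fst p'] measurable_compose[OF measurable_snd p']
  show ?thesis
    unfolding mh_a_def mh_accept_def by measurable
qed

text \<open>Tonelli's theorem makes the integrals of the positive and negative parts measurable in x
  separately.\<close>

lemma borel_measurable_ereal_integral:
  assumes "sigma_finite_measure M" and "f \<in> borel_measurable (N \<Otimes>\<^sub>M M)"
  shows "(\<lambda>x. ereal_integral M (\<lambda>y. f (x, y))) \<in> borel_measurable N"
proof -
  interpret sigma_finite_measure M by fact
  note [measurable] = assms(2)
  show ?thesis
    unfolding ereal_integral_def by measurable
qed

section \<open>Splitting the rate function into a density term and a holding term\<close>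

theorem proposition4p3:
  fixes S :: "'a::euclidean_space set"
    and \<pi> \<nu> :: "'a measure"
    and J q :: "'a \<Rightarrow> 'a measure"
    and p \<rho> :: "'a \<Rightarrow> real"
    and j \<alpha> :: "'a \<Rightarrow> 'a \<Rightarrow> real"
  assumes "polish_subset S"
    and "\<pi> \<in> space (prob_algebra (borel_on S))"
    and "J \<in> borel_on S \<rightarrow>\<^sub>M prob_algebra (borel_on S)"
    and "assumption_A1 S \<pi> p"
    and "assumption_A2 S \<pi> J j"
    and "\<nu> \<in> space (prob_algebra (borel_on S))"
    and "rate_fun S (mh_kernel S p j) \<nu> < \<infinity>"
    and "q \<in> borel_on S \<rightarrow>\<^sub>M prob_algebra (borel_on S)"
    and "invariant_for \<nu> q"
    and "rate_fun S (mh_kernel S p j) \<nu> =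
           ereal_integral \<nu> (\<lambda>x. rel_entropy (q x) (mh_kernel S p j x))"
    and "\<rho> \<in> borel_measurable (borel_on S)"
    and "AE x in \<nu>. 0 \<le> \<rho> x \<and> (\<forall>y\<in>S. 0 \<le> \<alpha> x y) \<and> \<alpha> x \<in> borel_measurable (borel_on S) \<and>
           q x = dens_plus_atom S (\<lambda>y. ennreal (\<alpha> x y)) (ennreal (\<rho> x)) x"
    and "AE x in \<nu>. absolutely_continuous
           (density (leb_on S) (\<lambda>y. ennreal (mh_a p j x y)))
           (density (leb_on S) (\<lambda>y. ennreal (\<alpha> x y)))"
  shows "rate_fun S (mh_kernel S p j) \<nu> =
           ereal_integral \<nu> (\<lambda>x. ereal_integral (leb_on S) (\<lambda>y. log_ratio (\<alpha> x y) (mh_a p j x y)))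
         + ereal_integral \<nu> (\<lambda>x. log_ratio (\<rho> x) (mh_r S p j x))"
proof -
  let ?B = "borel_on S" and ?L = "leb_on S" and ?K = "mh_kernel S p j"
  let ?a = "mh_a p j" and ?r = "mh_r S p j"
  let ?E = "\<lambda>x. ereal_integral ?L (\<lambda>y. log_ratio (\<alpha> x y) (?a x y))"
  let ?R = "\<lambda>x. log_ratio (\<rho> x) (?r x)"
  have S: "S \<in> sets borel" by (rule polish_subset_borel[OF assms(1)])
  interpret L: sigma_finite_measure ?L by (rule sigma_finite_leb_on[OF S])
  have sets_\<nu>: "sets \<nu> = sets ?B" and "prob_space \<nu>"
    using assms(6) by (auto simp: space_prob_algebra)
  interpret \<nu>: prob_space \<nu> by fact
  note m\<nu> = measurable_cong_sets[OF sets_\<nu> refl]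
  have sp: "space ?B = S" "space ?L = S" "space \<nu> = S"
    using sets_eq_imp_space_eq[OF sets_\<nu>] by (auto simp: space_restrict_space)
  have xS: "AE x in \<nu>. x \<in> S" using AE_space[of \<nu>] by (simp add: sp)
  have p: "\<And>x. x \<in> S \<Longrightarrow> 0 \<le> p x" "continuous_on S p"
    using assms(4) by (auto simp: assumption_A1_def)
  have j: "\<And>x. x \<in> S \<Longrightarrow> J x = density ?L (\<lambda>y. ennreal (j x y))"
    "continuous_on (S \<times> S) (\<lambda>(x, y). j x y)" "\<And>x y. x \<in> S \<Longrightarrow> y \<in> S \<Longrightarrow> 0 \<le> j x y"
    using assms(5) by (auto simp: assumption_A2_def intro: less_imp_le)
  have am: "(\<lambda>z. ?a (fst z) (snd z)) \<in> borel_measurable (?B \<Otimes>\<^sub>M ?B)"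
    by (rule borel_measurable_mh_a[OF p(2) j(2)])
  have am': "(\<lambda>z. ?a (fst z) (snd z)) \<in> borel_measurable (?B \<Otimes>\<^sub>M ?L)"
    using am by (simp add: measurable_cong_sets[OF sets_pair_measure_cong[OF refl sets_leb_on] refl])
  have amx: "?a x \<in> borel_measurable ?B" if "x \<in> S" for x
    using measurable_Pair2[OF am, of x] that sp by simp
  have ann: "0 \<le> ?a x y" if "x \<in> S" "y \<in> S" for x y
    using that p j by (intro mh_a_nonneg) auto
  \<comment> \<open>The acceptance probability is at most 1, so a(x, y) \<le> J(y|x), and the
    proposal has total mass 1.\<close>
  have aint: "(\<integral>\<^sup>+y. ennreal (?a x y) \<partial>?L) \<le> 1" if x: "x \<in> S" for x
  proof -
    have "(\<lambda>z. j (fst z) (snd z)) \<in> borel_measurable (?B \<Otimes>\<^sub>M ?B)"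
      using continuous_on_pair_measurable[OF j(2)] by (simp add: case_prod_unfold)
    then have "j x \<in> borel_measurable ?B"
      using measurable_Pair2[of _ ?B ?B borel x] x sp by fastforce
    then have jx: "j x \<in> borel_measurable ?L"
      by (simp add: measurable_cong_sets[OF sets_leb_on refl])
    have "(\<integral>\<^sup>+y. ennreal (?a x y) \<partial>?L) \<le> (\<integral>\<^sup>+y. ennreal (j x y) * indicator (space ?L) y \<partial>?L)"
      by (intro nn_integral_mono) (use j x sp in \<open>auto intro!: ennreal_leI mh_a_le\<close>)
    also have "\<dots> = emeasure (J x) (space ?L)"
      unfolding j(1)[OF x] using jx by (intro emeasure_density[symmetric]) auto
    also have "\<dots> = 1"
      using measurable_space[OF assms(3), of x] x sp sets_eq_imp_space_eq[of "J x" ?B]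
        prob_space.emeasure_space_1[of "J x"]
      by (auto simp: space_prob_algebra)
    finally show ?thesis .
  qed
  \<comment> \<open>Nonnegativity of r(x) ensures that \<open>ennreal\<close> does not truncate the
    atom weight in \<open>mh_kernel\<close>.\<close>
  have r: "0 \<le> ?r x" "?r x \<le> 1" if x: "x \<in> S" for x
  proof -
    have "?a x \<in> borel_measurable ?L"
      using amx[OF x] by (simp add: measurable_cong_sets[OF sets_leb_on refl])
    then have "(LINT y|?L. ?a x y) = enn2real (\<integral>\<^sup>+y. ennreal (?a x y) \<partial>?L)"
      using ann x sp by (intro integral_eq_nn_integral AE_I2) auto
    moreover have "enn2real (\<integral>\<^sup>+y. ennreal (?a x y) \<partial>?L) \<le> 1"
      using enn2real_mono[OF aint[OF x]] by simp
    ultimately show "0 \<le> ?r x" "?r x \<le> 1" by (simp_all add: mh_r_def)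
  qed
  have rm: "?r \<in> borel_measurable ?B"
    unfolding mh_r_def
    by (intro borel_measurable_diff borel_measurable_const L.borel_measurable_lebesgue_integral)
      (use am' in \<open>simp add: case_prod_unfold\<close>)

  obtain f where f: "f \<in> borel_measurable (?B \<Otimes>\<^sub>M ?B)"
    and f\<alpha>: "AE x in \<nu>. AE y in ?L. f (x, y) = ennreal (\<alpha> x y)"
  proof (rule jointly_measurable_density[OF S assms(6,8), of "\<lambda>x y. ennreal (\<alpha> x y)" "\<lambda>x. ennreal (\<rho> x)"])
    show "AE x in \<nu>. (\<lambda>y. ennreal (\<alpha> x y)) \<in> borel_measurable ?B \<and>
        q x = dens_plus_atom S (\<lambda>y. ennreal (\<alpha> x y)) (ennreal (\<rho> x)) x"
      using assms(12) by eventually_elim auto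
  qed
  \<comment> \<open>The inner integral formed from \<alpha> itself is not known to be measurable in
    x. This version is, and it agrees with \<open>?E\<close> for \<nu>-almost every x.\<close>
  define E where "E x = ereal_integral ?L (\<lambda>y. log_ratio (enn2real (f (x, y))) (?a x y))" for x
  have Em: "E \<in> borel_measurable \<nu>"
  proof -
    have "f \<in> borel_measurable (?B \<Otimes>\<^sub>M ?L)"
      using f by (simp add: measurable_cong_sets[OF sets_pair_measure_cong[OF refl sets_leb_on] refl])
    then have "(\<lambda>z. log_ratio (enn2real (f z)) (?a (fst z) (snd z))) \<in> borel_measurable (?B \<Otimes>\<^sub>M ?L)"
      using am' by measurable
    from borel_measurable_ereal_integral[OF L.sigma_finite_measure_axioms this]
    show ?thesis unfolding E_def m\<nu> by simp
  qed
  have Rm: "?R \<in> borel_measurable \<nu>"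
    unfolding m\<nu> using assms(11) rm by measurable
  have EE: "AE x in \<nu>. ?E x = E x"
    using f\<alpha> assms(12) xS
  proof eventually_elim
    case (elim x)
    show ?case
      unfolding E_def
    proof (rule ereal_integral_cong_AE, use elim(1) AE_space[of ?L] in eventually_elim)
      fix y assume "f (x, y) = ennreal (\<alpha> x y)" "y \<in> space ?L"
      then show "log_ratio (\<alpha> x y) (?a x y) = log_ratio (enn2real (f (x, y))) (?a x y)"
        using elim sp by simp
    qed
  qed
  have "AE x in \<nu>. e2ennreal (- E x) \<le> 1"
    using EE assms(12) xS
  proof eventually_elim
    case (elim x)
    have "e2ennreal (- ?E x) \<le> (\<integral>\<^sup>+y. e2ennreal (- log_ratio (\<alpha> x y) (?a x y)) \<partial>?L)"
      unfolding ereal_integral_def by (rule e2ennreal_uminus_diff_le)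
    also have "\<dots> \<le> (\<integral>\<^sup>+y. ennreal (?a x y) \<partial>?L)"
      by (intro nn_integral_mono log_ratio_neg_part_le) (use elim ann sp in auto)
    also have "\<dots> \<le> 1" using elim by (intro aint)
    finally show ?case using elim by simp
  qed
  then have "(\<integral>\<^sup>+x. e2ennreal (- E x) \<partial>\<nu>) \<le> (\<integral>\<^sup>+x. 1 \<partial>\<nu>)"
    by (rule nn_integral_mono_AE)
  then have Efin: "(\<integral>\<^sup>+x. e2ennreal (- E x) \<partial>\<nu>) \<noteq> \<infinity>"
    by (auto simp: \<nu>.emeasure_space_1 top_unique)
  have "AE x in \<nu>. e2ennreal (- ?R x) \<le> 1"
    using assms(12) xS
  proof eventually_elim
    case (elim x)
    then have "e2ennreal (- ?R x) \<le> ennreal (?r x)"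
      using r by (intro log_ratio_neg_part_le) auto
    also have "\<dots> \<le> 1" using r elim by simp
    finally show ?case .
  qed
  then have "(\<integral>\<^sup>+x. e2ennreal (- ?R x) \<partial>\<nu>) \<le> (\<integral>\<^sup>+x. 1 \<partial>\<nu>)"
    by (rule nn_integral_mono_AE)
  then have Rfin: "(\<integral>\<^sup>+x. e2ennreal (- ?R x) \<partial>\<nu>) \<noteq> \<infinity>"
    by (auto simp: \<nu>.emeasure_space_1 top_unique)
  \<comment> \<open>The pointwise splitting applies with u = \<alpha>(x, .), v = a(x, .), s =
    \<rho>(x) and t = r(x).\<close>
  have "AE x in \<nu>. rel_entropy (q x) (?K x) = E x + ?R x"
    using EE assms(12,13) xS
  proof eventually_elim
    case (elim x)
    then have fin: "(\<integral>\<^sup>+y. ennreal (?a x y) \<partial>?L) \<noteq> \<infinity>"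
      using aint[of x] by (auto simp: top_unique)
    have qx: "q x = dens_plus_atom S (\<lambda>y. ennreal (\<alpha> x y)) (ennreal (\<rho> x)) x"
      using elim by blast
    have "rel_entropy (q x) (?K x) = ?E x + ?R x"
      unfolding mh_kernel_def qx
      by (rule rel_entropy_dens_plus_atom) (use elim S amx ann r fin in auto)
    then show ?case using elim by simp
  qed
  then have "ereal_integral \<nu> (\<lambda>x. rel_entropy (q x) (?K x)) = ereal_integral \<nu> (\<lambda>x. E x + ?R x)"
    by (rule ereal_integral_cong_AE)
  also have "\<dots> = ereal_integral \<nu> E + ereal_integral \<nu> ?R"
    by (rule ereal_integral_add[OF Em Rm Efin Rfin])
  also have "ereal_integral \<nu> E = ereal_integral \<nu> ?E"
    using EE by (intro ereal_integral_cong_AE) (auto elim: eventually_mono)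
  \<comment> \<open>Attainment by \<open>q\<close> identifies the rate function with the integral of
    the relative entropies.\<close>
  finally show ?thesis unfolding assms(10) .
qed

end
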